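(* Let $k\ge 3$ and $\delta\ge k$ be integers and let $G$ be a connected graph of order $n$ with minimum degree $\delta(G)=\delta$. If $n\ge F(k,\delta)$ and $$q(G)\ge 2(n-\delta+k-3),$$ then $G$ is $k$-connected unless $G\in\mathcal{A}_1(n,k,\delta)$.
   Context: All graphs are simple and undirected. The $Q$-index $q(G)$ of a graph $G$ is the largest eigenvalue of its signless Laplacian $Q(G)=D(G)+A(G)$, where $D(G)$ is the diagonal matrix of vertex degrees and $A(G)$ is the adjacency matrix. A graph is $k$-connected if it has more than $k$ vertices and remains connected whenever fewer than $k$ vertices are deleted. $G\vee H$ denotes the join of $G$ and $H$ (disjoint union plus all edges between them), $K_r$ is the complete graph and $\overline{K_r}$ the empty graph on $r$ vertices. Define $$F(k,\delta)=(k^2+2k-3)\delta^2-(2k^3-k^2-17k+8)\delta+k^4-3k^3-8k^2+23k+4,$$ and $A(n,k,\delta)=K_{k-1}\vee(K_{\delta-k+2}\cup K_{n-\delta-1})$. In $A(n,k,\delta)$ let $X$ be the vertex set of the $K_{\delta-k+2}$ (vertices of degree $\delta$), $Y$ the vertex set of the $K_{k-1}$ (vertices of degree $n-1$), and $Z$ the vertex set of the $K_{n-\delta-1}$ (vertices of degree $n-\delta+k-3$). $\mathcal{A}_1(n,k,\delta)$ is the set of graphs $A(n,k,\delta)-E'$, where $E'$ is a set of edges of $A(n,k,\delta)$ with both endpoints in $Y\cup Z$ and $|E'|\le\left\lfloor\frac{(\delta-k+2)(k-1)}{4}\right\rfloor$. *)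

theory Defs
  imports
    "Graph_Theory.Graph_Theory"
    "Jordan_Normal_Form.Char_Poly"
begin

text \<open>
  Simple undirected graphs are the \<^locale>\<open>pair_graph\<close>s of \<open>Graph_Theory\<close>: finite, loop-free,
  with a symmetric arc relation. An undirected edge \<open>{u, v}\<close> corresponds to the two arcs
  \<open>(u, v)\<close> and \<open>(v, u)\<close>, so the degree of a vertex is its \<^const>\<open>out_degree\<close>.
\<close>

abbreviation vertex_degree :: "'a pair_pre_digraph \<Rightarrow> 'a \<Rightarrow> nat" where
  "vertex_degree G v \<equiv> out_degree (with_proj G) v"

definition min_degree :: "'a pair_pre_digraph \<Rightarrow> nat" where
  "min_degree G = Min (vertex_degree G ` pverts G)"

definition edges :: "'a pair_pre_digraph \<Rightarrow> 'a set set" where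
  "edges G = (\<lambda>(u, v). {u, v}) ` parcs G"

definition delete_edges :: "'a pair_pre_digraph \<Rightarrow> 'a set set \<Rightarrow> 'a pair_pre_digraph" where
  "delete_edges G E = \<lparr>pverts = pverts G, parcs = {(u, v) \<in> parcs G. {u, v} \<notin> E}\<rparr>"

definition k_connected :: "nat \<Rightarrow> 'a pair_pre_digraph \<Rightarrow> bool" where
  "k_connected k G \<longleftrightarrow>
     card (pverts G) > k \<and>
     (\<forall>S \<subseteq> pverts G. card S < k \<longrightarrow>
        Digraph_Component.connected (induce_subgraph (with_proj G) (pverts G - S)))"

definition isomorphic :: "'a pair_pre_digraph \<Rightarrow> 'b pair_pre_digraph \<Rightarrow> bool" where
  "isomorphic G H \<longleftrightarrow> digraph_iso (with_proj G) (with_proj H)"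


subsection \<open>Signless Laplacian\<close>

text \<open>
  Matrices are indexed by \<open>0, \<dots>, n - 1\<close>, so the vertices are listed in some order. The choice
  does not matter for the eigenvalues; see \<open>eigenvalue_signless_laplacian_iff\<close> below.
\<close>

definition vertex_list :: "'a pair_pre_digraph \<Rightarrow> 'a list" where
  "vertex_list G = (SOME vs. set vs = pverts G \<and> distinct vs)"

definition degree_mat :: "'a pair_pre_digraph \<Rightarrow> real mat" where
  "degree_mat G = mat (card (pverts G)) (card (pverts G))
     (\<lambda>(i, j). if i = j then real (vertex_degree G (vertex_list G ! i)) else 0)"

definition adjacency_mat :: "'a pair_pre_digraph \<Rightarrow> real mat" where
  "adjacency_mat G = mat (card (pverts G)) (card (pverts G))
     (\<lambda>(i, j). if (vertex_list G ! i, vertex_list G ! j) \<in> parcs G then 1 else 0)"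

definition signless_laplacian :: "'a pair_pre_digraph \<Rightarrow> real mat" where
  "signless_laplacian G = degree_mat G + adjacency_mat G"

definition q_index :: "'a pair_pre_digraph \<Rightarrow> real" where
  "q_index G = Max {\<mu>. eigenvalue (signless_laplacian G) \<mu>}"

lemma vertex_list:
  assumes "finite (pverts G)"
  shows "set (vertex_list G) = pverts G" "distinct (vertex_list G)"
    "length (vertex_list G) = card (pverts G)"
proof -
  have *: "set (vertex_list G) = pverts G \<and> distinct (vertex_list G)"
    unfolding vertex_list_def by (rule someI_ex) (use finite_distinct_list[OF assms] in blast)
  then show "set (vertex_list G) = pverts G" "distinct (vertex_list G)" by auto
  with distinct_card show "length (vertex_list G) = card (pverts G)" by metis
qed

lemma eigenvalue_signless_laplacian_iff:
  assumes "finite (pverts G)"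
  shows "eigenvalue (signless_laplacian G) \<mu> \<longleftrightarrow>
    (\<exists>x. (\<exists>v\<in>pverts G. x v \<noteq> 0) \<and>
      (\<forall>u\<in>pverts G. real (vertex_degree G u) * x u + (\<Sum>v | v \<in> pverts G \<and> (u, v) \<in> parcs G. x v) = \<mu> * x u))"
    (is "_ \<longleftrightarrow> (\<exists>x. ?P x)")
proof -
  define n where "n = card (pverts G)"
  define vs where "vs = vertex_list G"
  note vl = vertex_list[OF assms, folded vs_def n_def]
  have bij: "bij_betw ((!) vs) {..<n} (pverts G)"
    using bij_betw_nth[of vs "{..<n}" "pverts G"] vl by auto
  have ball: "(\<forall>u\<in>pverts G. R u) \<longleftrightarrow> (\<forall>i<n. R (vs ! i))" for R
    unfolding bij_betw_imp_surj_on[OF bij, symmetric] by auto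
  have bex: "(\<exists>u\<in>pverts G. R u) \<longleftrightarrow> (\<exists>i<n. R (vs ! i))" for R
    using ball[of "\<lambda>u. \<not> R u"] by auto
  have row: "(signless_laplacian G *\<^sub>v v) $ i =
      real (vertex_degree G (vs ! i)) * x (vs ! i) + (\<Sum>w | w \<in> pverts G \<and> (vs ! i, w) \<in> parcs G. x w)"
    if i: "i < n" and v: "v \<in> carrier_vec n" "\<And>j. j < n \<Longrightarrow> v $ j = x (vs ! j)" for v x i
  proof -
    have "(signless_laplacian G *\<^sub>v v) $ i =
        (\<Sum>j<n. (if i = j then real (vertex_degree G (vs ! i)) * x (vs ! j) else 0)
           + (if (vs ! i, vs ! j) \<in> parcs G then x (vs ! j) else 0))"
      using i v unfolding signless_laplacian_def degree_mat_def adjacency_mat_def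
        n_def[symmetric] vs_def[symmetric]
      by (auto simp: scalar_prod_def atLeast0LessThan algebra_simps intro!: sum.cong)
    also have "\<dots> = real (vertex_degree G (vs ! i)) * x (vs ! i)
        + (\<Sum>j<n. if (vs ! i, vs ! j) \<in> parcs G then x (vs ! j) else 0)"
      using i by (simp add: sum.distrib)
    also have "(\<Sum>j<n. if (vs ! i, vs ! j) \<in> parcs G then x (vs ! j) else 0)
        = (\<Sum>w\<in>pverts G. if (vs ! i, w) \<in> parcs G then x w else 0)"
      by (rule sum.reindex_bij_betw[OF bij])
    also have "\<dots> = (\<Sum>w | w \<in> pverts G \<and> (vs ! i, w) \<in> parcs G. x w)"
      using assms by (simp add: sum.inter_filter)
    finally show ?thesis .
  qed
  have dim: "dim_row (signless_laplacian G) = n"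
    by (simp add: signless_laplacian_def adjacency_mat_def n_def)
  have ev: "eigenvector (signless_laplacian G) v \<mu> \<longleftrightarrow> ?P x"
    if v: "v \<in> carrier_vec n" "\<And>j. j < n \<Longrightarrow> v $ j = x (vs ! j)" for v x
  proof -
    have "v \<noteq> 0\<^sub>v n \<longleftrightarrow> (\<exists>u\<in>pverts G. x u \<noteq> 0)"
      using v by (auto simp: bex vec_eq_iff)
    moreover have "signless_laplacian G *\<^sub>v v = \<mu> \<cdot>\<^sub>v v \<longleftrightarrow>
      (\<forall>i<n. (signless_laplacian G *\<^sub>v v) $ i = \<mu> * x (vs ! i))"
      using v dim by (auto simp: vec_eq_iff)
    ultimately show ?thesis
      unfolding eigenvector_def dim using v(1) row[OF _ v] by (simp add: ball)
  qed
  show ?thesis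
  proof
    assume "eigenvalue (signless_laplacian G) \<mu>"
    then obtain v where v: "eigenvector (signless_laplacian G) v \<mu>"
      by (auto simp: eigenvalue_def)
    define x where "x u = v $ (the_inv_into {..<n} ((!) vs) u)" for u
    have "v $ j = x (vs ! j)" if "j < n" for j
      using bij that unfolding x_def bij_betw_def by (simp add: the_inv_into_f_f)
    moreover have "v \<in> carrier_vec n" using v dim by (simp add: eigenvector_def)
    ultimately have "?P x" using ev[of v x] v by blast
    then show "\<exists>x. ?P x" by (rule exI[of "?P" x])
  next
    assume "\<exists>x. ?P x"
    then obtain x where "?P x" by (rule exE)
    with ev[of "vec n (\<lambda>j. x (vs ! j))" x]
    have "eigenvector (signless_laplacian G) (vec n (\<lambda>j. x (vs ! j))) \<mu>" by simp
    then show "eigenvalue (signless_laplacian G) \<mu>" unfolding eigenvalue_def ..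
  qed
qed


subsection \<open>The exceptional graphs\<close>

definition complete_graph :: "nat \<Rightarrow> nat pair_pre_digraph" where
  "complete_graph r = \<lparr>pverts = {..<r}, parcs = {(u, v). u < r \<and> v < r \<and> u \<noteq> v}\<rparr>"

definition disjoint_union ::
  "'a pair_pre_digraph \<Rightarrow> 'b pair_pre_digraph \<Rightarrow> ('a + 'b) pair_pre_digraph" where
  "disjoint_union G H =
     \<lparr>pverts = pverts G <+> pverts H,
      parcs = map_prod Inl Inl ` parcs G \<union> map_prod Inr Inr ` parcs H\<rparr>"

definition graph_join ::
  "'a pair_pre_digraph \<Rightarrow> 'b pair_pre_digraph \<Rightarrow> ('a + 'b) pair_pre_digraph" where
  "graph_join G H =
     \<lparr>pverts = pverts G <+> pverts H,
      parcs = parcs (disjoint_union G H)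
        \<union> (Inl ` pverts G) \<times> (Inr ` pverts H) \<union> (Inr ` pverts H) \<times> (Inl ` pverts G)\<rparr>"

text \<open>
  The subtractions below are on natural numbers; they do not truncate when
  \<open>1 \<le> k \<le> \<delta> + 2\<close> and \<open>\<delta> < n\<close>.
\<close>

definition A_graph :: "nat \<Rightarrow> nat \<Rightarrow> nat \<Rightarrow> (nat + nat + nat) pair_pre_digraph" where
  "A_graph n k \<delta> =
     graph_join (complete_graph (k - 1))
       (disjoint_union (complete_graph (\<delta> + 2 - k)) (complete_graph (n - \<delta> - 1)))"

definition A_Y :: "nat \<Rightarrow> (nat + nat + nat) set" where
  "A_Y k = Inl ` pverts (complete_graph (k - 1))"

definition A_Z :: "nat \<Rightarrow> nat \<Rightarrow> (nat + nat + nat) set" where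
  "A_Z n \<delta> = (Inr \<circ> Inr) ` pverts (complete_graph (n - \<delta> - 1))"

definition A1_graphs :: "nat \<Rightarrow> nat \<Rightarrow> nat \<Rightarrow> (nat + nat + nat) pair_pre_digraph set" where
  "A1_graphs n k \<delta> =
     {delete_edges (A_graph n k \<delta>) E | E.
        E \<subseteq> edges (A_graph n k \<delta>) \<and> (\<forall>e\<in>E. e \<subseteq> A_Y k \<union> A_Z n \<delta>) \<and>
        int (card E) \<le> \<lfloor>(real \<delta> - real k + 2) * (real k - 1) / 4\<rfloor>}"

definition F_bound :: "int \<Rightarrow> int \<Rightarrow> int" where
  "F_bound k \<delta> = (k^2 + 2*k - 3) * \<delta>^2 - (2*k^3 - k^2 - 17*k + 8) * \<delta>
     + k^4 - 3*k^3 - 8*k^2 + 23*k + 4"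

end

theory Submission
  imports Defs "Jordan_Normal_Form.Spectral_Radius"
begin

text \<open>
  Put \<open>t = k - 1\<close> and \<open>s = \<delta> - k + 2\<close>. If \<open>G\<close> is not \<open>k\<close>-connected, its vertices split
  into parts \<open>X\<close>, \<open>Y\<close>, \<open>Z\<close> with \<open>|Y| = t\<close>, no edge between \<open>X\<close> and \<open>Z\<close>, and
  \<open>s \<le> |X| \<le> n / 2\<close>. If \<open>|X| > s\<close>, the weights \<open>1\<close> on \<open>X \<union> Z\<close> and
  \<open>1 + (|X| - s) / t\<close> on \<open>Y\<close> bound the \<open>Q\<close>-index below \<open>2 (n - s - 1)\<close> (Collatz--Wielandt).
  If \<open>|X| = s\<close>, the minimum degree forces all edges meeting \<open>X\<close>. On \<open>W = Y \<union> Z\<close>,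
  of size \<open>m = n - s\<close>, write an eigenvector as its mean \<open>c\<close> plus a deviation \<open>z\<close> of sum zero.
  The quadratic form of the complete graph on \<open>W\<close> falls short of \<open>2 (m - 1)\<close> times the squared norm
  by \<open>m |z|\<^sup>2\<close>; the \<open>st\<close> edges between \<open>X\<close> and \<open>Y\<close> gain about \<open>st c\<^sup>2\<close> and
  each missing edge in \<open>W\<close> costs about \<open>4 c\<^sup>2\<close>. The cross terms are absorbed by AM-GM
  since \<open>n\<close> is large, so more than \<open>st / 4\<close> missing edges push the \<open>Q\<close>-index below \<open>2 (m - 1)\<close>.
\<close>

subsection \<open>The Q-index as an eigenvalue\<close>

text \<open>A complex eigenvalue \<open>l\<close> always exists. The hermitian form \<open>T\<close>
  of its eigenvector equals its own conjugate by symmetry, so \<open>l\<close> is real and hence a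
  root of the real characteristic polynomial.\<close>

lemma symmetric_real_mat_has_eigenvalue:
  fixes A :: "real mat"
  assumes A: "A \<in> carrier_mat n n" and "n > 0"
    and sym: "\<And>i j. i < n \<Longrightarrow> j < n \<Longrightarrow> A $$ (i, j) = A $$ (j, i)"
  shows "\<exists>\<mu>. eigenvalue A \<mu>"
proof -
  define B where "B = map_mat complex_of_real A"
  have B: "B \<in> carrier_mat n n" using A by (simp add: B_def)
  obtain l where l: "eigenvalue B l"
    using spectrum_non_empty[OF B \<open>n > 0\<close>] by (auto simp: spectrum_def)
  then obtain v where "eigenvector B v l" by (auto simp: eigenvalue_def)
  then have v: "v \<in> carrier_vec n" "v \<noteq> 0\<^sub>v n" "B *\<^sub>v v = l \<cdot>\<^sub>v v"
    using B by (auto simp: eigenvector_def)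
  have row: "(\<Sum>j<n. complex_of_real (A $$ (i, j)) * v $ j) = l * v $ i" if "i < n" for i
    using arg_cong[OF v(3), of "\<lambda>w. w $ i"] that v(1) A
    by (simp add: B_def scalar_prod_def atLeast0LessThan)
  define T where "T = (\<Sum>i<n. \<Sum>j<n. complex_of_real (A $$ (i, j)) * (cnj (v $ i) * v $ j))"
  define r where "r = (\<Sum>i<n. (norm (v $ i))\<^sup>2)"
  have T1: "T = l * complex_of_real r"
  proof -
    have "T = (\<Sum>i<n. cnj (v $ i) * (\<Sum>j<n. complex_of_real (A $$ (i, j)) * v $ j))"
      unfolding T_def by (simp add: sum_distrib_left ac_simps)
    also have "\<dots> = (\<Sum>i<n. l * complex_of_real ((norm (v $ i))\<^sup>2))"
      by (intro sum.cong refl)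
        (simp add: row del: of_real_power, simp add: complex_norm_square ac_simps del: of_real_power)
    finally show ?thesis by (simp add: r_def sum_distrib_left)
  qed
  have "cnj T = (\<Sum>i<n. \<Sum>j<n. complex_of_real (A $$ (i, j)) * (v $ i * cnj (v $ j)))"
    by (simp add: T_def)
  also have "\<dots> = T"
    unfolding T_def by (subst sum.swap) (intro sum.cong refl, simp add: sym mult.commute)
  finally have "Im (T) = 0" by (simp add: complex_eq_iff)
  moreover have "r > 0"
  proof -
    obtain i where "i < n" "v $ i \<noteq> 0" using v(1,2) by (auto simp: vec_eq_iff)
    then show ?thesis unfolding r_def by (intro sum_pos2[of _ i]) auto
  qed
  ultimately have "l = complex_of_real (Re l)" using T1 by (simp add: complex_eq_iff)
  then have "poly (char_poly B) (complex_of_real (Re l)) = 0"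
    using l by (simp add: eigenvalue_root_char_poly[OF B])
  then have "poly (char_poly A) (Re l) = 0"
    unfolding B_def of_real_hom.char_poly_hom[OF A] by simp
  then show ?thesis using eigenvalue_root_char_poly[OF A] by blast
qed

text \<open>\<open>q_index\<close> is a \<open>Max\<close>, which is attained only because the
  spectrum is finite and, by the previous lemma, non-empty.\<close>

lemma eigenvalue_q_index:
  assumes "pair_graph G" and "pverts G \<noteq> {}"
  shows "eigenvalue (signless_laplacian G) (q_index G)"
proof -
  interpret pair_graph G by fact
  let ?Q = "signless_laplacian G" and ?n = "card (pverts G)"
  have Q: "?Q \<in> carrier_mat ?n ?n"
    by (simp add: signless_laplacian_def degree_mat_def adjacency_mat_def)
  have n: "?n > 0" using assms(2) by (simp add: card_gt_0_iff)
  have "(u, v) \<in> parcs G \<longleftrightarrow> (v, u) \<in> parcs G" for u v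
    using pair_sym_arcs by (auto simp: symmetric_def sym_def)
  then have "?Q $$ (i, j) = ?Q $$ (j, i)" if "i < ?n" "j < ?n" for i j
    using that by (simp add: signless_laplacian_def degree_mat_def adjacency_mat_def)
  then have "spectrum ?Q \<noteq> {}"
    using symmetric_real_mat_has_eigenvalue[OF Q n] by (auto simp: spectrum_def)
  then have "Max (spectrum ?Q) \<in> spectrum ?Q"
    using card_finite_spectrum(1)[OF Q] by (intro Max_in)
  then show ?thesis by (simp add: spectrum_def q_index_def)
qed

lemma (in pair_graph) vertex_degree_eq_card: "vertex_degree G v = card (parcs G `` {v})"
proof -
  have "out_arcs (with_proj G) v = Pair v ` (parcs G `` {v})"
    by (auto simp: out_arcs_def)
  then show ?thesis by (simp add: out_degree_def card_image inj_on_def)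
qed

text \<open>Merging the degree term with the adjacency sum leaves one sum over neighbours. Both
  spectral bounds use the \<open>Q\<close>-index only through this equation.\<close>

lemma q_index_eigenfunction:
  assumes "pair_graph G" and "pverts G \<noteq> {}"
  obtains x where "\<exists>v\<in>pverts G. x v \<noteq> 0"
    and "\<And>u. u \<in> pverts G \<Longrightarrow> (\<Sum>v\<in>parcs G `` {u}. x u + x v) = q_index G * x u"
proof -
  interpret pair_graph G by fact
  have "{v. v \<in> pverts G \<and> (u, v) \<in> parcs G} = parcs G `` {u}" for u
    using arc_snd_in_verts by fastforce
  then show ?thesis
    using eigenvalue_q_index[OF assms] that
    unfolding eigenvalue_signless_laplacian_iff[OF pair_finite_verts]
    by (auto simp: vertex_degree_eq_card sum.distrib)
qed

subsection \<open>Spectral bound for a large separated part\<close>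

text \<open>Look at a vertex where the eigenfunction is largest relative to the weight.\<close>

lemma eigenvalue_less_by_weights:
  fixes x w :: "'a \<Rightarrow> real"
  assumes "finite V" and "E \<subseteq> V \<times> V"
    and nz: "\<exists>v\<in>V. x v \<noteq> 0"
    and ev: "\<And>u. u \<in> V \<Longrightarrow> (\<Sum>v\<in>E `` {u}. x u + x v) = \<mu> * x u"
    and pos: "\<And>u. u \<in> V \<Longrightarrow> w u > 0"
    and less: "\<And>u. u \<in> V \<Longrightarrow> (\<Sum>v\<in>E `` {u}. w u + w v) < \<beta> * w u"
  shows "\<mu> < \<beta>"
proof -
  define r where "r = Max ((\<lambda>v. \<bar>x v\<bar> / w v) ` V)"
  have "r \<in> (\<lambda>v. \<bar>x v\<bar> / w v) ` V" unfolding r_def using assms(1) nz by (intro Max_in) auto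
  then obtain u where u: "u \<in> V" "\<bar>x u\<bar> = r * w u" using pos by fastforce
  have le: "\<bar>x v\<bar> \<le> r * w v" if "v \<in> V" for v
  proof -
    have "\<bar>x v\<bar> / w v \<le> r" unfolding r_def using that assms(1) by simp
    then show ?thesis using pos[OF that] by (simp add: pos_divide_le_eq)
  qed
  obtain v where v: "v \<in> V" "x v \<noteq> 0" using nz by blast
  have "0 < r * w v" using le[OF v(1)] v(2) by linarith
  then have "r > 0" using pos[OF v(1)] by (simp add: zero_less_mult_iff)
  \<comment> \<open>This first inequality holds for either sign of \<open>\<mu>\<close>, so no sign
    assumption enters.\<close>
  have "\<mu> * \<bar>x u\<bar> \<le> \<bar>\<mu> * x u\<bar>" by (simp add: abs_mult mult_right_mono)
  also have "\<dots> \<le> (\<Sum>v\<in>E `` {u}. \<bar>x u + x v\<bar>)"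
    using ev[OF u(1)] by (metis sum_abs)
  also have "\<dots> \<le> (\<Sum>v\<in>E `` {u}. r * (w u + w v))"
  proof (rule sum_mono)
    fix v assume "v \<in> E `` {u}"
    then show "\<bar>x u + x v\<bar> \<le> r * (w u + w v)"
      using le[of v] u assms(2) abs_triangle_ineq[of "x u" "x v"] by (auto simp: algebra_simps)
  qed
  also have "\<dots> = r * (\<Sum>v\<in>E `` {u}. w u + w v)" by (rule sum_distrib_left[symmetric])
  also have "\<dots> < r * (\<beta> * w u)" using less[OF u(1)] \<open>r > 0\<close> by simp
  finally have "\<mu> * (r * w u) < \<beta> * (r * w u)" unfolding u(2) by (simp add: ac_simps)
  then show ?thesis using \<open>r > 0\<close> pos[OF u(1)] by (simp add: mult_less_cancel_right_pos)
qed

text \<open>Each part needs its own inequality: \<open>X\<close> uses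
  \<open>2 * card X \<le> n\<close> and the second bound on \<open>n\<close>, \<open>Y\<close> uses
  the first bound on \<open>n\<close>, and \<open>Z\<close> uses \<open>s < card X\<close>.\<close>

lemma eigenvalue_less_large_part:
  fixes x :: "'a \<Rightarrow> real" and s t n :: nat
  assumes fin: "finite X" "finite Y" "finite Z"
    and disj: "X \<inter> Y = {}" "X \<inter> Z = {}" "Y \<inter> Z = {}"
    and E: "E \<subseteq> (X \<union> Y \<union> Z) \<times> (X \<union> Y \<union> Z)" "irrefl E" "E \<inter> X \<times> Z = {}" "E \<inter> Z \<times> X = {}"
    and nz: "\<exists>v\<in>X \<union> Y \<union> Z. x v \<noteq> 0"
    and ev: "\<And>u. u \<in> X \<union> Y \<union> Z \<Longrightarrow> (\<Sum>v\<in>E `` {u}. x u + x v) = \<mu> * x u"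
    and card: "card Y = t" "card (X \<union> Y \<union> Z) = n" "2 * card X \<le> n" "s < card X" "0 < t"
    and n: "n > t + 2 * s + 2 * s * t" "n > 2 * s + 4 * t"
  shows "\<mu> < 2 * (real n - real s - 1)"
proof -
  define a b where "a = card X" and "b = card Z"
  have n_eq: "n = a + t + b"
    using card(1,2) fin disj by (simp add: a_def b_def card_Un_disjoint Int_Un_distrib2)
  define \<beta> where "\<beta> = (real a - real s) / real t"
  define w where "w v = (if v \<in> Y then 1 + \<beta> else 1)" for v
  have as: "real a > real s" using card(4) by (simp add: a_def)
  then have "\<beta> > 0" using card(5) by (simp add: \<beta>_def)
  have t\<beta>: "real t * \<beta> = real a - real s" using card(5) by (simp add: \<beta>_def)
  have nn: "real n = real a + real t + real b" using n_eq by simp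
  have two: "2 * real a \<le> real n" using card(3) by (simp add: a_def)
  have n2: "real n > 2 * real s + 4 * real t" using n(2) by linarith
  have n1: "real n > real t + 2 * real s + 2 * real s * real t"
    using of_nat_less_iff[where ?'a = real, THEN iffD2, OF n(1)] by simp
  have E_irrefl: "(u, u) \<notin> E" for u using E(2) by (auto simp: irrefl_def)
  have sumY: "(\<Sum>v\<in>Y. f (w v)) = t * f (1 + \<beta>)" for f :: "real \<Rightarrow> real"
    using card(1) by (simp add: w_def)
  have wX: "w v = 1" if "v \<in> X" for v using that disj by (auto simp: w_def)
  have wZ: "w v = 1" if "v \<in> Z" for v using that disj by (auto simp: w_def)
  have w0: "w v > 0" for v using \<open>\<beta> > 0\<close> by (simp add: w_def)
  have card_Diff1: "real (card (A - {u})) = real (card A) - 1" if "u \<in> A" "finite A" for u :: 'a and A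
    using card_Suc_Diff1[OF that(2,1)] by linarith
  have mono: "(\<Sum>v\<in>E `` {u}. w u + w v) \<le> (\<Sum>v\<in>N. w u + w v)"
    if "E `` {u} \<subseteq> N" "finite N" for u N
    using that w0 by (intro sum_mono2) (auto intro: less_imp_le add_pos_pos)
  show ?thesis
  proof (rule eigenvalue_less_by_weights[OF _ E(1) nz ev w0])
    show "finite (X \<union> Y \<union> Z)" using fin by simp
  next
    fix u assume "u \<in> X \<union> Y \<union> Z"
    then consider "u \<in> X" | "u \<in> Y" | "u \<in> Z" by blast
    then show "(\<Sum>v\<in>E `` {u}. w u + w v) < 2 * (real n - real s - 1) * w u"
    proof cases
      case 1
      have "E `` {u} \<subseteq> (X - {u}) \<union> Y" using 1 E(1,3) E_irrefl[of u] by auto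
      then have "(\<Sum>v\<in>E `` {u}. w u + w v) \<le> (\<Sum>v\<in>(X - {u}) \<union> Y. w u + w v)"
        using fin by (intro mono) auto
      also have "\<dots> = (\<Sum>v\<in>X - {u}. w u + w v) + (\<Sum>v\<in>Y. w u + w v)"
        using fin disj by (intro sum.union_disjoint) auto
      also have "(\<Sum>v\<in>X - {u}. w u + w v) = (\<Sum>v\<in>X - {u}. 2)"
        using 1 by (intro sum.cong) (auto simp: wX)
      also have "\<dots> = 2 * (real a - 1)" using 1 fin card_Diff1[of u X] by (simp add: a_def)
      also have "(\<Sum>v\<in>Y. w u + w v) = t * (1 + (1 + \<beta>))"
        using 1 sumY[of "\<lambda>c. 1 + c"] by (simp add: wX)
      also have "2 * (real a - 1) + t * (1 + (1 + \<beta>)) = 3 * real a - 2 - real s + 2 * real t"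
        using t\<beta> by (simp add: algebra_simps)
      also have "\<dots> < 2 * (real n - real s - 1)" using two n2 by argo
      finally show ?thesis using 1 by (simp add: wX)
    next
      case 2
      have wu: "w u = 1 + \<beta>" using 2 by (simp add: w_def)
      have "E `` {u} \<subseteq> (X \<union> Z) \<union> (Y - {u})" using 2 E(1) E_irrefl[of u] by auto
      then have "(\<Sum>v\<in>E `` {u}. w u + w v) \<le> (\<Sum>v\<in>(X \<union> Z) \<union> (Y - {u}). w u + w v)"
        using fin by (intro mono) auto
      also have "\<dots> = (\<Sum>v\<in>X \<union> Z. w u + w v) + (\<Sum>v\<in>Y - {u}. w u + w v)"
        using fin disj by (intro sum.union_disjoint) auto
      also have "(\<Sum>v\<in>X \<union> Z. w u + w v) = (\<Sum>v\<in>X \<union> Z. 2 + \<beta>)"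
        using 2 by (intro sum.cong) (auto simp: wX wZ wu)
      also have "\<dots> = (real a + real b) * (2 + \<beta>)"
        using fin disj by (simp add: a_def b_def card_Un_disjoint)
      also have "(\<Sum>v\<in>Y - {u}. w u + w v) = (\<Sum>v\<in>Y - {u}. 2 * (1 + \<beta>))"
        using 2 by (intro sum.cong) (auto simp: w_def)
      also have "\<dots> = 2 * (real t - 1) * (1 + \<beta>)"
        using 2 fin card(1) card_Diff1[of u Y] by (simp add: algebra_simps)
      \<comment> \<open>If all weights were \<open>1 + \<beta>\<close>, the sum would be
        \<open>2 * (n - 1) * (1 + \<beta>)\<close>; each of the \<open>n - t\<close> vertices
        outside \<open>Y\<close> falls short by \<open>\<beta>\<close>.\<close>
      also have "(real a + real b) * (2 + \<beta>) + 2 * (real t - 1) * (1 + \<beta>)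
          = 2 * (real n - 1) * (1 + \<beta>) - (real n - real t) * \<beta>"
        using nn by (simp add: algebra_simps)
      also have "\<dots> < 2 * (real n - 1) * (1 + \<beta>) - 2 * real s * (1 + \<beta>)"
      proof -
        have "(2 * real s * real t) / real t < (real n - real t - 2 * real s) * (1 / real t)"
          using n1 card(5) by (simp add: field_simps)
        also have "\<dots> \<le> (real n - real t - 2 * real s) * \<beta>"
        proof -
          \<comment> \<open>Integrality gives \<open>\<beta> \<ge> 1 / t\<close>, the only lower
            bound on \<open>\<beta>\<close> available here.\<close>
          have "1 \<le> real a - real s" using card(4) by (simp add: a_def)
          moreover have "real n - real t - 2 * real s \<ge> 0" using n2 by linarith
          ultimately show ?thesis unfolding \<beta>_def
            by (intro mult_left_mono divide_right_mono) auto
        qed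
        finally have "2 * real s < (real n - real t - 2 * real s) * \<beta>" using card(5) by simp
        then show ?thesis by (simp add: algebra_simps)
      qed
      finally show ?thesis by (simp add: wu algebra_simps)
    next
      case 3
      have "E `` {u} \<subseteq> (Z - {u}) \<union> Y" using 3 E(1,4) E_irrefl[of u] by auto
      then have "(\<Sum>v\<in>E `` {u}. w u + w v) \<le> (\<Sum>v\<in>(Z - {u}) \<union> Y. w u + w v)"
        using fin by (intro mono) auto
      also have "\<dots> = (\<Sum>v\<in>Z - {u}. w u + w v) + (\<Sum>v\<in>Y. w u + w v)"
        using fin disj by (intro sum.union_disjoint) auto
      also have "(\<Sum>v\<in>Z - {u}. w u + w v) = (\<Sum>v\<in>Z - {u}. 2)"
        using 3 by (intro sum.cong) (auto simp: wZ)
      also have "\<dots> = 2 * (real b - 1)" using 3 fin card_Diff1[of u Z] by (simp add: b_def)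
      also have "(\<Sum>v\<in>Y. w u + w v) = t * (1 + (1 + \<beta>))"
        using 3 sumY[of "\<lambda>c. 1 + c"] by (simp add: wZ)
      also have "2 * (real b - 1) + t * (1 + (1 + \<beta>)) = 2 * (real n - 1) - real a - real s"
        using t\<beta> nn by (simp add: algebra_simps)
      also have "\<dots> < 2 * (real n - real s - 1)" using as by simp
      finally show ?thesis using 3 by (simp add: wZ)
    qed
  qed
qed

subsection \<open>Spectral bound for many missing edges\<close>

text \<open>The sum of \<open>(x u + x v)^2\<close> over edges is the quadratic form of the signless
  Laplacian. Every edge appears as two arcs, whence the factor 2; reversing arcs shows that both
  endpoints contribute equally.\<close>

lemma sum_arcs_square:
  fixes x :: "'a \<Rightarrow> real"
  assumes "finite V" and E: "E \<subseteq> V \<times> V" "sym E"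
    and ev: "\<And>u. u \<in> V \<Longrightarrow> (\<Sum>v\<in>E `` {u}. x u + x v) = \<mu> * x u"
  shows "(\<Sum>(u, v)\<in>E. (x u + x v)\<^sup>2) = 2 * \<mu> * (\<Sum>u\<in>V. (x u)\<^sup>2)"
proof -
  have Sig: "E = Sigma V (\<lambda>u. E `` {u})" using E(1) by auto
  have fE: "finite (E `` {u})" for u
    using E(1) \<open>finite V\<close> by (auto intro: finite_subset[of _ V])
  have bij: "bij_betw prod.swap E E"
    using E(2) by (intro bij_betwI[where g = prod.swap]) (auto simp: sym_def)
  have swap: "(\<Sum>(u, v)\<in>E. (x u + x v) * x v) = (\<Sum>(u, v)\<in>E. (x u + x v) * x u)"
  proof -
    have "(\<Sum>(u, v)\<in>E. (x u + x v) * x v) = (\<Sum>p\<in>E. case prod.swap p of (u, v) \<Rightarrow> (x u + x v) * x v)"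
      using bij by (rule sum.reindex_bij_betw[symmetric])
    also have "\<dots> = (\<Sum>(u, v)\<in>E. (x u + x v) * x u)"
      by (intro sum.cong refl) (auto simp: add.commute)
    finally show ?thesis .
  qed
  have "(\<Sum>(u, v)\<in>E. (x u + x v)\<^sup>2)
      = (\<Sum>(u, v)\<in>E. (x u + x v) * x u) + (\<Sum>(u, v)\<in>E. (x u + x v) * x v)"
    unfolding sum.distrib[symmetric]
    by (intro sum.cong refl) (auto simp: power2_eq_square algebra_simps)
  also have "\<dots> = 2 * (\<Sum>(u, v)\<in>E. (x u + x v) * x u)" using swap by simp
  also have "(\<Sum>(u, v)\<in>E. (x u + x v) * x u) = (\<Sum>u\<in>V. \<Sum>v\<in>E `` {u}. (x u + x v) * x u)"
    using \<open>finite V\<close> fE by (subst Sig, subst sum.Sigma[symmetric]) auto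
  also have "\<dots> = (\<Sum>u\<in>V. (\<mu> * x u) * x u)"
    by (intro sum.cong refl) (simp only: sum_distrib_right[symmetric] ev)
  finally show ?thesis by (simp add: sum_distrib_left power2_eq_square ac_simps)
qed

section \<open>Elementary identities and inequalities for sums over vertices and arcs\<close>

lemma sum_power2_le_power2_sum:
  fixes f :: "'a \<Rightarrow> real"
  assumes "finite A" and "\<And>a. a \<in> A \<Longrightarrow> f a \<ge> 0"
  shows "(\<Sum>a\<in>A. (f a)\<^sup>2) \<le> (\<Sum>a\<in>A. f a)\<^sup>2"
  using assms
proof (induction A rule: finite_induct)
  case (insert a A)
  then have "0 \<le> f a * sum f A" by (auto intro!: mult_nonneg_nonneg sum_nonneg)
  then show ?case using insert by (simp add: power2_sum)
qed simp

text \<open>Cauchy-Schwarz against the constant function.\<close>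

lemma power2_sum_le_card:
  fixes f :: "'a \<Rightarrow> real"
  shows "(\<Sum>a\<in>A. f a)\<^sup>2 \<le> real (card A) * (\<Sum>a\<in>A. (f a)\<^sup>2)"
proof -
  have "2 * (\<Sum>a\<in>A. f a)\<^sup>2 = (\<Sum>a\<in>A. \<Sum>b\<in>A. 2 * f a * f b)"
    by (simp add: power2_eq_square sum_product sum_distrib_left sum_distrib_right mult_ac)
  also have "\<dots> \<le> (\<Sum>a\<in>A. \<Sum>b\<in>A. (f a)\<^sup>2 + (f b)\<^sup>2)"
    by (intro sum_mono sum_squares_bound)
  also have "\<dots> = 2 * (real (card A) * (\<Sum>a\<in>A. (f a)\<^sup>2))"
    by (simp add: sum.distrib sum_distrib_left[symmetric])
  finally show ?thesis by simp
qed

text \<open>This is the quadratic form of a complete graph: expand over all of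
  \<open>A \<times> A\<close>, then remove the diagonal, where each term is
  \<open>4 * (x u)^2\<close>.\<close>

lemma sum_pairs_square:
  fixes x :: "'a \<Rightarrow> real"
  assumes "finite A"
  shows "(\<Sum>(u, v)\<in>{(u, v) \<in> A \<times> A. u \<noteq> v}. (x u + x v)\<^sup>2)
    = (2 * real (card A) - 4) * (\<Sum>u\<in>A. (x u)\<^sup>2) + 2 * (\<Sum>u\<in>A. x u)\<^sup>2"
proof -
  let ?f = "\<lambda>(u, v). (x u + x v)\<^sup>2"
  have "sum ?f (A \<times> A) = (\<Sum>u\<in>A. \<Sum>v\<in>A. (x u)\<^sup>2 + (x v)\<^sup>2 + 2 * (x u * x v))"
    unfolding sum.cartesian_product[symmetric] by (simp add: power2_sum mult.assoc)
  also have "\<dots> = 2 * real (card A) * (\<Sum>u\<in>A. (x u)\<^sup>2) + 2 * (\<Sum>u\<in>A. x u)\<^sup>2"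
    by (simp add: sum.distrib sum_distrib_left[symmetric] sum_distrib_right[symmetric] power2_eq_square)
  finally have "sum ?f (A \<times> A) = \<dots>" .
  moreover have "sum ?f ((\<lambda>u. (u, u)) ` A) = 4 * (\<Sum>u\<in>A. (x u)\<^sup>2)"
    by (subst sum.reindex) (auto simp: inj_on_def sum_distrib_left power2_eq_square algebra_simps)
  moreover have "sum ?f (A \<times> A) = sum ?f {(u, v) \<in> A \<times> A. u \<noteq> v} + sum ?f ((\<lambda>u. (u, u)) ` A)"
  proof -
    have "A \<times> A = {(u, v) \<in> A \<times> A. u \<noteq> v} \<union> (\<lambda>u. (u, u)) ` A" (is "_ = ?B \<union> ?D") by auto
    then have "sum ?f (A \<times> A) = sum ?f (?B \<union> ?D)" by (rule arg_cong)
    moreover have "finite {(u, v) \<in> A \<times> A. u \<noteq> v}"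
      by (rule finite_subset[of _ "A \<times> A"]) (use assms in auto)
    ultimately show ?thesis
      using assms sum.union_disjoint[of ?B ?D ?f] by fastforce
  qed
  ultimately show ?thesis by (simp add: algebra_simps)
qed

text \<open>Double counting with \<open>D v\<close> the number of incidences of \<open>v\<close>
  with arcs of \<open>M\<close>. It turns a linear term over missing arcs into an inner product with
  \<open>z\<close>, to which AM-GM applies vertex by vertex.\<close>

lemma sum_arcs_endpoints:
  fixes z :: "'a \<Rightarrow> real"
  assumes "finite W" and "M \<subseteq> W \<times> W"
  obtains D where "\<And>v. D v \<ge> 0" and "sum D W = 2 * real (card M)"
    and "(\<Sum>(u, v)\<in>M. z u + z v) = (\<Sum>v\<in>W. D v * z v)"
proof
  define D where "D v = (\<Sum>p\<in>M. of_bool (fst p = v) + of_bool (snd p = v) :: real)" for v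
  show "D v \<ge> 0" for v by (simp add: D_def sum_nonneg)
  have *: "(\<Sum>v\<in>W. D v * f v) = (\<Sum>(u, v)\<in>M. f u + f v)" for f :: "'a \<Rightarrow> real"
  proof -
    have "(\<Sum>v\<in>W. D v * f v)
        = (\<Sum>p\<in>M. \<Sum>v\<in>W. (of_bool (fst p = v) + of_bool (snd p = v)) * f v)"
      unfolding D_def sum_distrib_right by (rule sum.swap)
    also have "\<dots> = (\<Sum>(u, v)\<in>M. f u + f v)"
    proof (intro sum.cong refl)
      fix p assume "p \<in> M"
      then have "fst p \<in> W" "snd p \<in> W" using assms(2) by auto
      then show "(\<Sum>v\<in>W. (of_bool (fst p = v) + of_bool (snd p = v)) * f v) = (case p of (u, v) \<Rightarrow> f u + f v)"
        using \<open>finite W\<close>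
        by (simp add: distrib_right sum.distrib of_bool_def if_distrib[of "\<lambda>c. c * _"] sum.delta
            case_prod_beta cong: if_cong)
    qed
    finally show ?thesis .
  qed
  from *[of z] show "(\<Sum>(u, v)\<in>M. z u + z v) = (\<Sum>v\<in>W. D v * z v)" ..
  from *[of "\<lambda>_. 1"] show "sum D W = 2 * real (card M)" by (simp add: case_prod_beta)
qed

text \<open>\<open>M\<close> holds just \<open>2 * e\<close> of the missing arcs and
  \<open>E\<close> is only bounded from above, so further missing edges do no harm. The lower bound
  on \<open>e\<close> makes the loss exceed the gain; the upper bound keeps the cross terms
  small.\<close>

lemma eigenvalue_less_many_missing:
  fixes x :: "'a \<Rightarrow> real" and s t m e :: nat
  assumes fin: "finite X" "finite W"
    and disj: "X \<inter> W = {}" and "Y \<subseteq> W"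
    and M: "M \<subseteq> {(u, v) \<in> W \<times> W. u \<noteq> v}" "card M = 2 * e"
    and E: "sym E" "E \<subseteq> ({(u, v) \<in> W \<times> W. u \<noteq> v} - M) \<union> X \<times> Y \<union> Y \<times> X \<union> {(u, v) \<in> X \<times> X. u \<noteq> v}"
    and nz: "\<exists>v\<in>X \<union> W. x v \<noteq> 0"
    and ev: "\<And>u. u \<in> X \<union> W \<Longrightarrow> (\<Sum>v\<in>E `` {u}. x u + x v) = \<mu> * x u"
    and card: "card X = s" "card Y = t" "card W = m" "0 < t"
    and e: "s * t < 4 * e" "4 * e \<le> s * t + 4"
    and m: "s * t\<^sup>2 + t * s\<^sup>2 + (s * t + 4)\<^sup>2 + 2 * s + 2 * t < m"
  shows "\<mu> < 2 * (real m - 1)"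
proof (rule ccontr)
  assume "\<not> ?thesis"
  then have \<mu>: "\<mu> \<ge> 2 * (real m - 1)" by simp
  \<comment> \<open>\<open>N\<close> is the AM-GM weight. It is small enough that the final
    coefficients of \<open>Qa\<close> and \<open>Qz\<close> are \<open>- m\<close> and
    \<open>- 2 * t\<close>, and by \<open>m\<close> large enough to make \<open>\<theta>\<close>
    below positive.\<close>
  define N where "N = real m - 2 * real s - 2 * real t"
  have N: "real s * (real t)\<^sup>2 + real t * (real s)\<^sup>2 + (real s * real t + 4)\<^sup>2 < N"
    using of_nat_less_iff[where ?'a = real, THEN iffD2, OF m] by (simp add: N_def)
  have "N > 0" by (rule le_less_trans[OF _ N]) simp
  have "m > 0" using m by simp
  have finY: "finite Y" using fin(2) \<open>Y \<subseteq> W\<close> by (rule finite_subset[rotated])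
  define c where "c = (\<Sum>v\<in>W. x v) / m"
  define z where "z v = x v - c" for v
  have x: "x v = c + z v" for v by (simp add: z_def)
  have z0: "(\<Sum>v\<in>W. z v) = 0"
    using \<open>m > 0\<close> card(3) by (simp add: z_def sum_subtractf c_def)
  define Qa where "Qa = (\<Sum>v\<in>X. (x v)\<^sup>2)"
  define Qz where "Qz = (\<Sum>v\<in>W. (z v)\<^sup>2)"
  define Sa where "Sa = (\<Sum>v\<in>X. x v)"
  define Sy where "Sy = (\<Sum>v\<in>Y. z v)"
  have Q0: "Qa \<ge> 0" "Qz \<ge> 0" by (simp_all add: Qa_def Qz_def sum_nonneg)
  have QyQz: "(\<Sum>v\<in>Y. (z v)\<^sup>2) \<le> Qz"
    unfolding Qz_def using fin \<open>Y \<subseteq> W\<close> by (intro sum_mono2) auto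
  have QW: "(\<Sum>v\<in>W. (x v)\<^sup>2) = m * c\<^sup>2 + Qz"
    using z0 card(3) by (simp add: x power2_sum sum.distrib Qz_def sum_distrib_left[symmetric] mult.assoc)
  have SW: "(\<Sum>v\<in>W. x v) = m * c" using z0 card(3) by (simp add: x sum.distrib)
  let ?f = "\<lambda>(u, v). (x u + x v)\<^sup>2"
  obtain D where D: "\<And>v. D v \<ge> 0" "sum D W = 2 * real (card M)"
    "(\<Sum>(u, v)\<in>M. z u + z v) = (\<Sum>v\<in>W. D v * z v)"
    using sum_arcs_endpoints[OF fin(2), of M z] M(1) by blast
  have finM: "finite M" by (rule finite_subset[OF M(1)]) (rule finite_subset[of _ "W \<times> W"], use fin in auto)
  have f0: "?f p \<ge> 0" for p by (simp add: case_prod_beta)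
  define Wp where "Wp = {(u, v) \<in> W \<times> W. u \<noteq> v}"
  define Xp where "Xp = {(u, v) \<in> X \<times> X. u \<noteq> v}"
  have finp: "finite Wp" "finite Xp" unfolding Wp_def Xp_def
    by (rule finite_subset[of _ "W \<times> W"], use fin in auto) (rule finite_subset[of _ "X \<times> X"], use fin in auto)
  have "2 * \<mu> * (Qa + (m * c\<^sup>2 + Qz)) = sum ?f E"
  proof -
    have "E \<subseteq> (X \<union> W) \<times> (X \<union> W)" using E(2) \<open>Y \<subseteq> W\<close> by auto
    from sum_arcs_square[OF _ this E(1) ev] fin disj show ?thesis
      by (simp add: sum.union_disjoint Qa_def QW)
  qed
  \<comment> \<open>All terms are squares, so enlarging the arc set can only increase the
    sum.\<close>
  also have "\<dots> \<le> sum ?f ((Wp - M) \<union> X \<times> Y \<union> Y \<times> X \<union> Xp)"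
    using E(2) fin finY finp f0 unfolding Wp_def[symmetric] Xp_def[symmetric]
    by (intro sum_mono2) auto
  also have "\<dots> = sum ?f (Wp - M) + sum ?f (X \<times> Y) + sum ?f (Y \<times> X) + sum ?f Xp"
    using fin finY finp disj \<open>Y \<subseteq> W\<close>
    by (subst sum.union_disjoint; (subst sum.union_disjoint)?; (subst sum.union_disjoint)?)
       (auto simp: Wp_def Xp_def)
  also have "sum ?f (Wp - M) = sum ?f Wp - sum ?f M"
    using M(1) finp by (intro sum_diff) (auto simp: Wp_def)
  also have "sum ?f (Y \<times> X) = sum ?f (X \<times> Y)"
    unfolding sum.cartesian_product[symmetric]
    by (subst sum.swap) (simp add: add.commute)
  also have "sum ?f Wp = (2 * real m - 4) * (m * c\<^sup>2 + Qz) + 2 * (m * c)\<^sup>2"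
    unfolding Wp_def sum_pairs_square[OF fin(2)] QW SW card(3) ..
  also have "sum ?f Xp = (2 * real s - 4) * Qa + 2 * Sa\<^sup>2"
    unfolding Xp_def sum_pairs_square[OF fin(1)] Qa_def Sa_def card(1) ..
  finally have main: "2 * \<mu> * (Qa + (m * c\<^sup>2 + Qz)) \<le> (2 * real m - 4) * (m * c\<^sup>2 + Qz) + 2 * (m * c)\<^sup>2
      - sum ?f M + 2 * sum ?f (X \<times> Y) + ((2 * real s - 4) * Qa + 2 * Sa\<^sup>2)" by simp
  define H where "H = (\<Sum>v\<in>W. D v * z v)"
  \<comment> \<open>Expand \<open>(2 * c + (z u + z v))^2\<close> and drop the square of the
    deviation; the \<open>2 * e\<close> arcs give \<open>8 * e * c^2\<close>.\<close>
  have fM: "sum ?f M \<ge> 8 * real e * c\<^sup>2 + 4 * c * H"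
  proof -
    have "8 * real e * c\<^sup>2 + 4 * c * H = (\<Sum>(u, v)\<in>M. 4 * c\<^sup>2 + 4 * c * (z u + z v))"
      using D(3) M(2) by (simp add: sum.distrib case_prod_beta H_def sum_distrib_left[symmetric])
    also have "\<dots> \<le> sum ?f M"
    proof (intro sum_mono)
      fix p show "(case p of (u, v) \<Rightarrow> 4 * c\<^sup>2 + 4 * c * (z u + z v)) \<le> ?f p"
        using zero_le_power2[of "z (fst p) + z (snd p)"]
        by (simp add: x case_prod_beta power2_eq_square algebra_simps)
    qed
    finally show ?thesis .
  qed
  \<comment> \<open>Only the endpoint in \<open>Y\<close> is split into \<open>c + z v\<close>; the
    remaining \<open>(x u + z v)^2\<close> is at most
    \<open>2 * ((x u)^2 + (z v)^2)\<close>.\<close>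
  have fXY: "sum ?f (X \<times> Y) \<le> s * t * c\<^sup>2 + 2 * c * (t * Sa + s * Sy) + 2 * (t * Qa + s * Qz)"
  proof -
    have "sum ?f (X \<times> Y) \<le> (\<Sum>(u, v)\<in>X \<times> Y. c\<^sup>2 + 2 * c * (x u + z v) + 2 * ((x u)\<^sup>2 + (z v)\<^sup>2))"
    proof (intro sum_mono)
      fix p show "?f p \<le> (case p of (u, v) \<Rightarrow> c\<^sup>2 + 2 * c * (x u + z v) + 2 * ((x u)\<^sup>2 + (z v)\<^sup>2))"
        using zero_le_power2[of "x (fst p) - z (snd p)"]
        by (simp add: x[of "snd p"] case_prod_beta power2_eq_square algebra_simps)
    qed
    also have "\<dots> = s * t * c\<^sup>2 + 2 * c * (t * Sa + s * Sy) + 2 * (t * Qa + s * (\<Sum>v\<in>Y. (z v)\<^sup>2))"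
      unfolding sum.cartesian_product[symmetric]
      using card by (simp add: sum.distrib sum_distrib_left[symmetric] Sa_def Sy_def Qa_def)
    also have "\<dots> \<le> s * t * c\<^sup>2 + 2 * c * (t * Sa + s * Sy) + 2 * (t * Qa + s * Qz)"
      using QyQz by (simp add: mult_left_mono)
    finally show ?thesis .
  qed
  have Sa2: "Sa\<^sup>2 \<le> s * Qa"
    using power2_sum_le_card[of x X] card(1) by (simp add: Sa_def Qa_def)
  \<comment> \<open>\<open>h\<close> is the joint coefficient of \<open>z\<close> in the linear
    terms from the \<open>X\<close>-\<open>Y\<close> arcs and from the missing arcs, so a single
    AM-GM treats both.\<close>
  define h where "h v = (if v \<in> Y then real s else 0) - D v" for v
  have h_sum: "s * Sy - H = (\<Sum>v\<in>W. h v * z v)"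
  proof -
    have "(\<Sum>v\<in>W. (if v \<in> Y then real s else 0) * z v) = s * Sy"
      using fin(2) \<open>Y \<subseteq> W\<close>
      by (simp add: if_distrib[of "\<lambda>c. c * _"] sum.If_cases Int_absorb1 Sy_def sum_distrib_left cong: if_cong)
    then show ?thesis by (simp add: h_def left_diff_distrib sum_subtractf H_def)
  qed
  have h2: "(\<Sum>v\<in>W. (h v)\<^sup>2) \<le> t * (real s)\<^sup>2 + 16 * (real e)\<^sup>2"
  proof -
    have "(\<Sum>v\<in>W. (h v)\<^sup>2) \<le> (\<Sum>v\<in>W. (if v \<in> Y then (real s)\<^sup>2 else 0) + (D v)\<^sup>2)"
      using D(1) by (intro sum_mono) (auto simp: h_def power2_diff)
    also have "\<dots> = t * (real s)\<^sup>2 + (\<Sum>v\<in>W. (D v)\<^sup>2)"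
      using fin(2) \<open>Y \<subseteq> W\<close> card(2) by (simp add: sum.distrib sum.If_cases Int_absorb1)
    also have "(\<Sum>v\<in>W. (D v)\<^sup>2) \<le> (sum D W)\<^sup>2"
      using fin(2) D(1) by (intro sum_power2_le_power2_sum)
    also have "\<dots> = 16 * (real e)\<^sup>2" using D(2) M(2) by (simp add: power_mult_distrib)
    finally show ?thesis by simp
  qed
  have amgm: "2 * (c * (p * q)) \<le> c\<^sup>2 * p\<^sup>2 / N + N * q\<^sup>2" for p q
  proof -
    have "0 \<le> (c * p - N * q)\<^sup>2 / N" using \<open>N > 0\<close> by simp
    also have "\<dots> = c\<^sup>2 * p\<^sup>2 / N + N * q\<^sup>2 - 2 * (c * (p * q))"
      using \<open>N > 0\<close> by (simp add: field_simps power2_eq_square)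
    finally show ?thesis by simp
  qed
  have a1: "2 * c * (t * Sa) \<le> c\<^sup>2 * (s * (real t)\<^sup>2) / N + N * Qa"
  proof -
    have "2 * c * (t * Sa) = (\<Sum>v\<in>X. 2 * (c * (t * x v)))"
      by (simp add: Sa_def sum_distrib_left mult.assoc)
    also have "\<dots> \<le> (\<Sum>v\<in>X. c\<^sup>2 * (real t)\<^sup>2 / N + N * (x v)\<^sup>2)" by (intro sum_mono amgm)
    also have "\<dots> = c\<^sup>2 * (s * (real t)\<^sup>2) / N + N * Qa"
      using card(1) by (simp add: sum.distrib Qa_def sum_distrib_left)
    finally show ?thesis .
  qed
  have a2: "2 * c * (s * Sy - H) \<le> c\<^sup>2 * (t * (real s)\<^sup>2 + 16 * (real e)\<^sup>2) / N + N * Qz"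
  proof -
    have "2 * c * (s * Sy - H) = (\<Sum>v\<in>W. 2 * (c * (h v * z v)))"
      by (simp add: h_sum sum_distrib_left mult.assoc)
    also have "\<dots> \<le> (\<Sum>v\<in>W. c\<^sup>2 * (h v)\<^sup>2 / N + N * (z v)\<^sup>2)" by (intro sum_mono amgm)
    also have "\<dots> = c\<^sup>2 * (\<Sum>v\<in>W. (h v)\<^sup>2) / N + N * Qz"
      by (simp add: sum.distrib Qz_def sum_distrib_left sum_divide_distrib)
    also have "\<dots> \<le> c\<^sup>2 * (t * (real s)\<^sup>2 + 16 * (real e)\<^sup>2) / N + N * Qz"
      using h2 \<open>N > 0\<close> by (intro add_right_mono divide_right_mono mult_left_mono) auto
    finally show ?thesis .
  qed
  \<comment> \<open>By integrality \<open>4 * e\<close> exceeds \<open>s * t\<close> by at least 1.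
    Of this one unit of \<open>c^2\<close>, \<open>\<theta>\<close> is what remains after both AM-GM
    estimates.\<close>
  define \<theta> where "\<theta> = 1 - (s * (real t)\<^sup>2 + (t * (real s)\<^sup>2 + 16 * (real e)\<^sup>2)) / N"
  have "\<theta> > 0"
  proof -
    have "real (4 * e) \<le> real (s * t + 4)" using e(2) by (simp only: of_nat_le_iff)
    then have "(4 * real e)\<^sup>2 \<le> (real s * real t + 4)\<^sup>2" by (intro power_mono) auto
    then have "s * (real t)\<^sup>2 + (t * (real s)\<^sup>2 + 16 * (real e)\<^sup>2) < N"
      using N by (simp add: power_mult_distrib)
    then show ?thesis using \<open>N > 0\<close> by (simp add: \<theta>_def)
  qed
  have e1: "1 \<le> 4 * real e - real s * real t"
  proof -
    have "real (s * t + 1) \<le> real (4 * e)" using e(1) by (simp only: of_nat_le_iff)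
    then show ?thesis by simp
  qed
  have "0 \<le> Qa + (m * c\<^sup>2 + Qz)" using Q0 by simp
  then have "2 * (2 * (real m - 1)) * (Qa + (m * c\<^sup>2 + Qz)) \<le> 2 * \<mu> * (Qa + (m * c\<^sup>2 + Qz))"
    using \<mu> by (intro mult_right_mono) auto
  \<comment> \<open>The terms in \<open>m * c^2\<close> cancel: constants on \<open>W\<close> are
    eigenvectors of the complete graph with eigenvalue \<open>2 * (m - 1)\<close>.\<close>
  with main fM fXY Sa2
  have "0 \<le> 2 * (s * t * c\<^sup>2 - 4 * e * c\<^sup>2 + 2 * c * (t * Sa) + 2 * c * (s * Sy - H)
      + (2 * real t + 2 * real s - 2 * real m) * Qa + (2 * real s - real m) * Qz)"
    by (simp add: power2_eq_square algebra_simps)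
  then have "0 \<le> s * t * c\<^sup>2 - 4 * e * c\<^sup>2 + (c\<^sup>2 - \<theta> * c\<^sup>2)
      + (2 * real t + 2 * real s - 2 * real m + N) * Qa + (2 * real s - real m + N) * Qz"
    using a1 a2 by (simp add: \<theta>_def algebra_simps add_divide_distrib)
  also have "\<dots> = - (4 * real e - real s * real t - 1) * c\<^sup>2 - \<theta> * c\<^sup>2 - m * Qa - 2 * t * Qz"
    by (simp add: N_def algebra_simps)
  also have "\<dots> \<le> - (\<theta> * c\<^sup>2 + m * Qa + 2 * t * Qz)"
    using mult_right_mono[OF e1, of "c\<^sup>2"] by (simp add: algebra_simps)
  finally have "\<theta> * c\<^sup>2 + m * Qa + 2 * t * Qz \<le> 0" by simp
  moreover have "\<theta> * c\<^sup>2 \<ge> 0" "m * Qa \<ge> 0" "2 * t * Qz \<ge> 0"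
    using \<open>\<theta> > 0\<close> Q0 by auto
  \<comment> \<open>Strictness comes from here: equality would force the eigenfunction to vanish on
    both \<open>X\<close> and \<open>W\<close>.\<close>
  ultimately have "\<theta> * c\<^sup>2 = 0" "m * Qa = 0" "2 * t * Qz = 0" by linarith+
  then have "c = 0" "Qa = 0" "Qz = 0" using \<open>\<theta> > 0\<close> \<open>m > 0\<close> \<open>0 < t\<close> by auto
  then have "x v = 0" if "v \<in> X \<union> W" for v
    using that fin by (auto simp: Qa_def Qz_def sum_nonneg_eq_0_iff z_def)
  then show False using nz by blast
qed

subsection \<open>Separations and the exceptional graphs\<close>

text \<open>Delete a separating set \<open>S\<close> and split the rest into a reachability class
  and its complement. The smaller side becomes \<open>X\<close>; vertices of the larger side fill
  \<open>S\<close> up to exactly \<open>k - 1\<close>, which preserves the separation.\<close>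

lemma not_k_connected_partition:
  assumes "pair_graph G" and "\<not> k_connected k G"
    and "card (pverts G) > k" and "card (pverts G) \<ge> 2 * (k - 1)"
  obtains X Y Z where "pverts G = X \<union> Y \<union> Z" "X \<inter> Y = {}" "X \<inter> Z = {}" "Y \<inter> Z = {}"
    "card Y = k - 1" "X \<noteq> {}" "2 * card X \<le> card (pverts G)"
    "parcs G \<inter> X \<times> Z = {}" "parcs G \<inter> Z \<times> X = {}"
proof -
  interpret pair_graph G by fact
  have symG: "(u, v) \<in> parcs G \<longleftrightarrow> (v, u) \<in> parcs G" for u v
    using pair_sym_arcs by (auto simp: symmetric_def sym_def)
  note finV = pair_finite_verts
  obtain S where S: "S \<subseteq> pverts G" "card S < k"
    "\<not> Digraph_Component.connected (induce_subgraph (with_proj G) (pverts G - S))"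
    using assms(2,3) by (auto simp: k_connected_def)
  have finS: "finite S" using S(1) finV by (rule finite_subset)
  \<comment> \<open>Connectedness is defined through the symmetric closure. Since the arcs of
    \<open>G\<close> are symmetric already, \<open>H\<close> is just the induced subgraph.\<close>
  define H where "H = mk_symmetric (induce_subgraph (with_proj G) (pverts G - S))"
  have H: "pverts H = pverts G - S"
    "parcs H = {(u, v) \<in> parcs G. u \<notin> S \<and> v \<notin> S}"
    using symG arc_fst_in_verts arc_snd_in_verts
    by (fastforce simp: H_def parcs_mk_symmetric)+
  interpret H: pair_wf_digraph H
    using arc_fst_in_verts arc_snd_in_verts by unfold_locales (fastforce simp: H)+
  have "pverts G - S \<noteq> {}"
    using S assms(3) card_mono[OF finS, of "pverts G"] by auto
  then obtain u v where uv: "u \<in> pverts G - S" "v \<in> pverts G - S" "\<not> u \<rightarrow>\<^sup>*\<^bsub>with_proj H\<^esub> v"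
    using S(3) unfolding Digraph_Component.connected_def strongly_connected_def H_def[symmetric]
    by (auto simp: H)
  define C where "C = {w \<in> pverts G - S. u \<rightarrow>\<^sup>*\<^bsub>with_proj H\<^esub> w}"
  define D where "D = pverts G - S - C"
  have CD: "(p, q) \<notin> parcs G" if "p \<in> C" "q \<in> D" for p q
  proof
    assume "(p, q) \<in> parcs G"
    then have "(p, q) \<in> parcs H" using that by (auto simp: H C_def D_def)
    then have "u \<rightarrow>\<^sup>*\<^bsub>with_proj H\<^esub> q"
      using that(1) H.reachable_adj_trans[of u p q] by (auto simp: C_def)
    then show False using that(2) by (auto simp: C_def D_def)
  qed
  have DC: "(p, q) \<notin> parcs G" if "p \<in> D" "q \<in> C" for p q
    using CD[OF that(2,1)] symG by blast
  have "u \<in> C" "v \<in> D" using uv H.reachable_refl[of u] by (auto simp: C_def D_def H)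
  moreover have "pverts G - S = C \<union> D" "C \<inter> D = {}" by (auto simp: C_def D_def)
  ultimately obtain P Q where PQ: "pverts G - S = P \<union> Q" "P \<inter> Q = {}" "P \<noteq> {}" "card P \<le> card Q"
    "\<And>p q. p \<in> P \<Longrightarrow> q \<in> Q \<Longrightarrow> (p, q) \<notin> parcs G"
  proof (cases "card C \<le> card D")
    case True
    with \<open>u \<in> C\<close> \<open>pverts G - S = C \<union> D\<close> \<open>C \<inter> D = {}\<close> CD show ?thesis by (intro that[of C D]) auto
  next
    case False
    with \<open>v \<in> D\<close> \<open>pverts G - S = C \<union> D\<close> \<open>C \<inter> D = {}\<close> DC show ?thesis
      by (intro that[of D C]) auto
  qed
  have fin: "finite P" "finite Q" using PQ(1) finV by (metis finite_Diff finite_Un)+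
  have "card P + card Q = card (pverts G) - card S"
    using PQ(1,2) fin card_Un_disjoint[of P Q] card_Diff_subset[OF finS S(1)] by simp
  then have PQc: "card P + card Q + card S = card (pverts G)"
    using card_mono[OF finV S(1)] by simp
  \<comment> \<open>The larger side has at least \<open>(card (pverts G) - card S) / 2\<close>
    vertices, enough to fill up \<open>S\<close>. It may be used up entirely, leaving
    \<open>Z\<close> empty.\<close>
  have "k - 1 - card S \<le> card Q" using PQc PQ(4) assms(4) by linarith
  then obtain T where T: "T \<subseteq> Q" "card T = k - 1 - card S"
    by (meson obtain_subset_with_card_n)
  show ?thesis
  proof (rule that[of P "S \<union> T" "Q - T"])
    show "pverts G = P \<union> (S \<union> T) \<union> (Q - T)" using PQ(1) S(1) T(1) by auto
    show "P \<inter> (S \<union> T) = {}" "P \<inter> (Q - T) = {}" "(S \<union> T) \<inter> (Q - T) = {}"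
      using PQ(1,2) T(1) by auto
    have "S \<inter> T = {}" using PQ(1) T(1) by auto
    then show "card (S \<union> T) = k - 1"
      using finS T fin(2) S(2) by (simp add: card_Un_disjoint finite_subset)
    show "P \<noteq> {}" by fact
    show "2 * card P \<le> card (pverts G)" using PQc PQ(4) by linarith
    show "parcs G \<inter> P \<times> (Q - T) = {}" "parcs G \<inter> (Q - T) \<times> P = {}" using PQ(5) symG by blast+
  qed
qed

section \<open>Recognising graphs of the exceptional family up to isomorphism\<close>

text \<open>A digraph isomorphism also maps arcs. For arcs that are vertex pairs this map is forced
  to be \<open>map_prod f f\<close>.\<close>

lemma isomorphicI:
  assumes "pair_wf_digraph G" and "bij_betw f (pverts G) (pverts H)"
    and "parcs H \<subseteq> pverts H \<times> pverts H"
    and arcs: "\<And>u v. u \<in> pverts G \<Longrightarrow> v \<in> pverts G \<Longrightarrow> (u, v) \<in> parcs G \<longleftrightarrow> (f u, f v) \<in> parcs H"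
  shows "isomorphic G H"
proof -
  interpret pair_wf_digraph G by fact
  define h where "h = \<lparr>iso_verts = f, iso_arcs = map_prod f f, iso_head = snd, iso_tail = fst\<rparr>"
  have inj: "inj_on f (pverts G)" and surj: "f ` pverts G = pverts H"
    using assms(2) by (auto simp: bij_betw_def)
  have sub: "parcs G \<subseteq> pverts G \<times> pverts G" using arc_fst_in_verts arc_snd_in_verts by fastforce
  have "map_prod f f ` parcs G = parcs H"
  proof
    show "map_prod f f ` parcs G \<subseteq> parcs H" using sub arcs by auto
    show "parcs H \<subseteq> map_prod f f ` parcs G"
    proof
      fix p assume p: "p \<in> parcs H"
      then obtain u v where "u \<in> pverts G" "v \<in> pverts G" "p = (f u, f v)"
        using assms(3) surj by (cases p) blast
      with p arcs show "p \<in> map_prod f f ` parcs G" by force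
    qed
  qed
  then have "with_proj H = app_iso h (with_proj G)"
    using surj by (simp add: with_proj_def app_iso_def h_def)
  moreover have "inj_on (map_prod f f) (parcs G)"
    using map_prod_inj_on[OF inj inj] sub by (rule inj_on_subset)
  then have "pre_digraph.digraph_isomorphism (with_proj G) h"
    using inj wf_digraph_axioms by (auto simp: pre_digraph.digraph_isomorphism_def h_def)
  ultimately show ?thesis unfolding isomorphic_def digraph_iso_def by blast
qed

text \<open>Each doubleton comes from both orientations of its pair, which differ by
  irreflexivity.\<close>

lemma card_doubletons_le:
  assumes "finite M" "sym M" "irrefl M"
  shows "2 * card ((\<lambda>(u, v). {u, v}) ` M) \<le> card M"
proof -
  let ?h = "\<lambda>(u, v). {u, v}"
  have "2 * card (?h ` M) = (\<Sum>e\<in>?h ` M. 2)" by simp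
  also have "\<dots> \<le> (\<Sum>e\<in>?h ` M. card {p \<in> M. ?h p = e})"
  proof (rule sum_mono)
    fix e assume "e \<in> ?h ` M"
    then obtain u v where uv: "(u, v) \<in> M" "e = {u, v}" by auto
    then have "(v, u) \<in> M" "u \<noteq> v" using assms(2,3) by (auto simp: sym_def irrefl_def)
    then have "card {(u, v), (v, u)} = 2" "{(u, v), (v, u)} \<subseteq> {p \<in> M. ?h p = e}"
      using uv by auto
    moreover have "finite {p \<in> M. ?h p = e}" using assms(1) by simp
    ultimately show "2 \<le> card {p \<in> M. ?h p = e}"
      using card_mono[of "{p \<in> M. ?h p = e}" "{(u, v), (v, u)}"] by linarith
  qed
  also have "\<dots> = card M"
    using sum.image_gen[OF assms(1), of "\<lambda>_. 1::nat" ?h] by simp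
  finally show ?thesis .
qed

text \<open>Rewrite rules for the nine block pairs: \<open>Inl\<close> is \<open>Y\<close>,
  \<open>Inr (Inl _)\<close> is \<open>X\<close> and \<open>Inr (Inr _)\<close> is
  \<open>Z\<close>.\<close>

lemma parcs_A_graph_iff:
  "(Inl a, Inl b) \<in> parcs (A_graph n k \<delta>) \<longleftrightarrow> a < k - 1 \<and> b < k - 1 \<and> a \<noteq> b"
  "(Inl a, Inr (Inl b)) \<in> parcs (A_graph n k \<delta>) \<longleftrightarrow> a < k - 1 \<and> b < \<delta> + 2 - k"
  "(Inl a, Inr (Inr b)) \<in> parcs (A_graph n k \<delta>) \<longleftrightarrow> a < k - 1 \<and> b < n - \<delta> - 1"
  "(Inr (Inl a), Inl b) \<in> parcs (A_graph n k \<delta>) \<longleftrightarrow> a < \<delta> + 2 - k \<and> b < k - 1"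
  "(Inr (Inl a), Inr (Inl b)) \<in> parcs (A_graph n k \<delta>) \<longleftrightarrow> a < \<delta> + 2 - k \<and> b < \<delta> + 2 - k \<and> a \<noteq> b"
  "(Inr (Inl a), Inr (Inr b)) \<notin> parcs (A_graph n k \<delta>)"
  "(Inr (Inr a), Inl b) \<in> parcs (A_graph n k \<delta>) \<longleftrightarrow> a < n - \<delta> - 1 \<and> b < k - 1"
  "(Inr (Inr a), Inr (Inl b)) \<notin> parcs (A_graph n k \<delta>)"
  "(Inr (Inr a), Inr (Inr b)) \<in> parcs (A_graph n k \<delta>) \<longleftrightarrow> a < n - \<delta> - 1 \<and> b < n - \<delta> - 1 \<and> a \<noteq> b"
proof -
  have *: "(c, d) \<in> map_prod g h ` S \<longleftrightarrow> (\<exists>x y. (x, y) \<in> S \<and> c = g x \<and> d = h y)"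
    for c :: 'c and d :: 'e and g :: "'b \<Rightarrow> 'c" and h :: "'d \<Rightarrow> 'e" and S by force
  note [simp] = this A_graph_def graph_join_def disjoint_union_def complete_graph_def
  show "(Inl a, Inl b) \<in> parcs (A_graph n k \<delta>) \<longleftrightarrow> a < k - 1 \<and> b < k - 1 \<and> a \<noteq> b"
    "(Inl a, Inr (Inl b)) \<in> parcs (A_graph n k \<delta>) \<longleftrightarrow> a < k - 1 \<and> b < \<delta> + 2 - k"
    "(Inl a, Inr (Inr b)) \<in> parcs (A_graph n k \<delta>) \<longleftrightarrow> a < k - 1 \<and> b < n - \<delta> - 1"
    "(Inr (Inl a), Inl b) \<in> parcs (A_graph n k \<delta>) \<longleftrightarrow> a < \<delta> + 2 - k \<and> b < k - 1"
    "(Inr (Inl a), Inr (Inl b)) \<in> parcs (A_graph n k \<delta>) \<longleftrightarrow> a < \<delta> + 2 - k \<and> b < \<delta> + 2 - k \<and> a \<noteq> b"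
    "(Inr (Inl a), Inr (Inr b)) \<notin> parcs (A_graph n k \<delta>)"
    "(Inr (Inr a), Inl b) \<in> parcs (A_graph n k \<delta>) \<longleftrightarrow> a < n - \<delta> - 1 \<and> b < k - 1"
    "(Inr (Inr a), Inr (Inl b)) \<notin> parcs (A_graph n k \<delta>)"
    "(Inr (Inr a), Inr (Inr b)) \<in> parcs (A_graph n k \<delta>) \<longleftrightarrow> a < n - \<delta> - 1 \<and> b < n - \<delta> - 1 \<and> a \<noteq> b"
    by auto
qed

text \<open>All adjacencies meeting \<open>X\<close> are prescribed, so \<open>G\<close> is
  determined by the pairs missing inside \<open>Y \<union> Z\<close>. Numbering each block carries
  these pairs to the deleted edge set.\<close>

lemma isomorphic_A1_graph:
  fixes G :: "'a pair_pre_digraph"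
  assumes "pair_graph G" and V: "pverts G = X \<union> Y \<union> Z"
    and disj: "X \<inter> Y = {}" "X \<inter> Z = {}" "Y \<inter> Z = {}"
    and card: "card X = \<delta> + 2 - k" "card Y = k - 1" "card Z = n - \<delta> - 1"
    and XZ: "parcs G \<inter> X \<times> Z = {}" "parcs G \<inter> Z \<times> X = {}"
    and X: "\<And>u v. u \<in> X \<Longrightarrow> v \<in> X \<union> Y \<Longrightarrow> u \<noteq> v \<Longrightarrow> (u, v) \<in> parcs G"
    and M: "M = {(u, v) \<in> (Y \<union> Z) \<times> (Y \<union> Z). u \<noteq> v} - parcs G"
    and few: "4 * card ((\<lambda>(u, v). {u, v}) ` M) \<le> (\<delta> + 2 - k) * (k - 1)"
    and k: "1 \<le> k" "k \<le> \<delta> + 2"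
  shows "\<exists>H \<in> A1_graphs n k \<delta>. isomorphic G H"
proof -
  interpret pair_graph G by fact
  have symG: "(u, v) \<in> parcs G \<longleftrightarrow> (v, u) \<in> parcs G" for u v
    using pair_sym_arcs by (auto simp: symmetric_def sym_def)
  have irr: "(u, u) \<notin> parcs G" for u using pair_no_loops[of "(u, u)"] by auto
  have fin: "finite X" "finite Y" "finite Z" using pair_finite_verts unfolding V by auto
  obtain gX gY gZ where
    "bij_betw gX X {0..<card X}" "bij_betw gY Y {0..<card Y}" "bij_betw gZ Z {0..<card Z}"
    using fin ex_bij_betw_finite_nat by metis
  then have g: "bij_betw gX X {..<\<delta> + 2 - k}" "bij_betw gY Y {..<k - 1}" "bij_betw gZ Z {..<n - \<delta> - 1}"
    by (simp_all add: card atLeast0LessThan)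
  define f where "f u = (if u \<in> Y then Inl (gY u) else if u \<in> X then Inr (Inl (gX u)) else Inr (Inr (gZ u)))" for u
  have fY: "f u = Inl (gY u)" if "u \<in> Y" for u using that by (simp add: f_def)
  have fX: "f u = Inr (Inl (gX u))" if "u \<in> X" for u using that disj by (auto simp: f_def)
  have fZ: "f u = Inr (Inr (gZ u))" if "u \<in> Z" for u using that disj by (auto simp: f_def)
  let ?A = "A_graph n k \<delta>"
  have gin: "u \<in> X \<Longrightarrow> gX u < \<delta> + 2 - k" "u \<in> Y \<Longrightarrow> gY u < k - 1" "u \<in> Z \<Longrightarrow> gZ u < n - \<delta> - 1" for u
    using g by (auto dest: bij_betwE)
  have ginj: "u \<in> X \<Longrightarrow> v \<in> X \<Longrightarrow> gX u = gX v \<longleftrightarrow> u = v"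
    "u \<in> Y \<Longrightarrow> v \<in> Y \<Longrightarrow> gY u = gY v \<longleftrightarrow> u = v"
    "u \<in> Z \<Longrightarrow> v \<in> Z \<Longrightarrow> gZ u = gZ v \<longleftrightarrow> u = v" for u v
    using g by (auto simp: bij_betw_def dest: inj_onD)
  have inj: "f u = f v \<longleftrightarrow> u = v" if "u \<in> pverts G" "v \<in> pverts G" for u v
    using that disj unfolding V by (auto simp: fX fY fZ ginj)
  have surj: "f ` pverts G = pverts ?A"
  proof -
    have "f ` Y = Inl ` gY ` Y" "f ` X = Inr ` Inl ` gX ` X" "f ` Z = Inr ` Inr ` gZ ` Z"
      by (simp_all add: fX fY fZ image_image)
    then have "f ` Y = Inl ` {..<k - 1}" "f ` X = Inr ` Inl ` {..<\<delta> + 2 - k}" "f ` Z = Inr ` Inr ` {..<n - \<delta> - 1}"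
      using g by (simp_all only: bij_betw_imp_surj_on)
    then show ?thesis
      unfolding V by (auto simp: image_Un A_graph_def graph_join_def disjoint_union_def complete_graph_def Plus_def)
  qed
  have A_arcs: "(f u, f v) \<in> parcs ?A \<longleftrightarrow> u \<noteq> v \<and> (u, v) \<notin> X \<times> Z \<and> (u, v) \<notin> Z \<times> X"
    if "u \<in> pverts G" "v \<in> pverts G" for u v
  proof -
    have part: "w \<in> X \<and> w \<notin> Y \<and> w \<notin> Z \<or> w \<notin> X \<and> w \<in> Y \<and> w \<notin> Z \<or> w \<notin> X \<and> w \<notin> Y \<and> w \<in> Z"
      if "w \<in> pverts G" for w
      using that disj unfolding V by blast
    show ?thesis
      using part[OF that(1)] part[OF that(2)]
      by (elim disjE conjE;
          simp only: parcs_A_graph_iff fX fY fZ gin ginj mem_Sigma_iff simp_thms; blast?)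
  qed
  \<comment> \<open>As an image of the missing doubletons, \<open>E\<close> has at most as many
    elements as there are missing edges.\<close>
  define E where "E = (`) f ` (\<lambda>(u, v). {u, v}) ` M"
  have E_eq: "E = (\<lambda>(u, v). {f u, f v}) ` M"
    by (simp add: E_def image_image case_prod_beta)
  have in_E: "{f u, f v} \<in> E \<longleftrightarrow> (u, v) \<in> M" if "u \<in> pverts G" "v \<in> pverts G" for u v
  proof
    assume "{f u, f v} \<in> E"
    then obtain p q where pq: "(p, q) \<in> M" "{f u, f v} = {f p, f q}" by (auto simp: E_eq)
    then have "p \<in> pverts G" "q \<in> pverts G" "(q, p) \<in> M" by (auto simp: M V symG)
    then show "(u, v) \<in> M" using pq inj that by (auto simp: doubleton_eq_iff)
  next
    assume "(u, v) \<in> M"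
    from imageI[OF this, of "\<lambda>(u, v). {f u, f v}"] show "{f u, f v} \<in> E" by (simp add: E_eq)
  qed
  have M_arcs: "(f u, f v) \<in> parcs ?A" "{f u, f v} \<subseteq> A_Y k \<union> A_Z n \<delta>" if "(u, v) \<in> M" for u v
  proof -
    have "u \<in> Y \<union> Z" "v \<in> Y \<union> Z" "u \<noteq> v" using that by (auto simp: M)
    then show "(f u, f v) \<in> parcs ?A" using disj by (subst A_arcs) (auto simp: V)
    show "{f u, f v} \<subseteq> A_Y k \<union> A_Z n \<delta>"
      using \<open>u \<in> Y \<union> Z\<close> \<open>v \<in> Y \<union> Z\<close> gin
      by (auto simp: fY fZ A_Y_def A_Z_def complete_graph_def)
  qed
  have "finite M"
    by (rule finite_subset[of _ "(Y \<union> Z) \<times> (Y \<union> Z)"]) (use fin in \<open>auto simp: M\<close>)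
  then have "card E \<le> card ((\<lambda>(u, v). {u, v}) ` M)"
    unfolding E_def by (intro card_image_le finite_imageI)
  with few have "4 * card E \<le> (\<delta> + 2 - k) * (k - 1)" by linarith
  then have "real (4 * card E) \<le> real ((\<delta> + 2 - k) * (k - 1))" by (simp only: of_nat_le_iff)
  moreover have sizes: "real ((\<delta> + 2 - k) * (k - 1)) = (real \<delta> - real k + 2) * (real k - 1)"
    using k by (simp add: of_nat_diff)
  ultimately have "int (card E) \<le> \<lfloor>(real \<delta> - real k + 2) * (real k - 1) / 4\<rfloor>"
    unfolding sizes by (simp add: le_floor_iff)
  moreover have "E \<subseteq> edges ?A"
  proof
    fix e assume "e \<in> E"
    then obtain u v where uv: "(u, v) \<in> M" "e = {f u, f v}" by (auto simp: E_eq)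
    from imageI[OF M_arcs(1)[OF uv(1)], of "\<lambda>(u, v). {u, v}"] show "e \<in> edges ?A"
      by (simp add: edges_def uv(2))
  qed
  moreover have "\<forall>e\<in>E. e \<subseteq> A_Y k \<union> A_Z n \<delta>"
  proof
    fix e assume "e \<in> E"
    then obtain u v where uv: "(u, v) \<in> M" "e = {f u, f v}" by (auto simp: E_eq)
    show "e \<subseteq> A_Y k \<union> A_Z n \<delta>" using M_arcs(2)[OF uv(1)] by (simp only: uv(2))
  qed
  ultimately have "delete_edges ?A E \<in> A1_graphs n k \<delta>" by (auto simp: A1_graphs_def)
  moreover have "isomorphic G (delete_edges ?A E)"
  proof (rule isomorphicI)
    show "pair_wf_digraph G" ..
    show "bij_betw f (pverts G) (pverts (delete_edges ?A E))"
      using inj surj by (auto simp: bij_betw_def inj_on_def delete_edges_def)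
    show "parcs (delete_edges ?A E) \<subseteq> pverts (delete_edges ?A E) \<times> pverts (delete_edges ?A E)"
      by (auto simp: delete_edges_def A_graph_def graph_join_def disjoint_union_def complete_graph_def)
    fix u v assume uv: "u \<in> pverts G" "v \<in> pverts G"
    have "(u, v) \<in> parcs G \<longleftrightarrow> u \<noteq> v \<and> (u, v) \<notin> X \<times> Z \<and> (u, v) \<notin> Z \<times> X \<and> (u, v) \<notin> M"
      using uv XZ X[of u v] X[of v u] symG[of u v] irr[of u] unfolding V M by auto
    then show "(u, v) \<in> parcs G \<longleftrightarrow> (f u, f v) \<in> parcs (delete_edges ?A E)"
      using uv by (simp add: delete_edges_def A_arcs in_E)
  qed
  ultimately show ?thesis by blast
qed

section \<open>Arithmetic of the lower bound on the order\<close>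

text \<open>In the variables \<open>s\<close> and \<open>t\<close> all coefficients are positive, so
  the bound can be handled over the natural numbers.\<close>

lemma F_bound_eq:
  assumes "1 \<le> k" "k \<le> \<delta> + 1" and s: "s = \<delta> + 2 - k" and t: "t = k - 1"
  shows "F_bound (int k) (int \<delta>) = int (t * (t + 4) * s\<^sup>2 + (t\<^sup>2 + 5 * t + 8) * s + t + 9)"
proof -
  have "int k = int t + 1" "int \<delta> = int s + int t - 1" using assms by auto
  then show ?thesis
    by (simp only: F_bound_def) (simp add: power2_eq_square power3_eq_cube power4_eq_xxxx algebra_simps)
qed

text \<open>These are the size conditions of the two spectral bounds. The last has
  \<open>3 * s\<close> in place of \<open>2 * s\<close> because it is applied with
  \<open>m = n - s\<close>.\<close>

lemma order_bounds:
  fixes s t n :: nat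
  assumes n: "n \<ge> t * (t + 4) * s\<^sup>2 + (t\<^sup>2 + 5 * t + 8) * s + t + 9" and "2 \<le> s" "2 \<le> t"
  shows "t + 2 * s + 2 * s * t < n" "2 * s + 4 * t < n"
    "s * t\<^sup>2 + t * s\<^sup>2 + (s * t + 4)\<^sup>2 + 3 * s + 2 * t < n"
proof -
  \<comment> \<open>After shifting by 2, the right-hand sides dominate coefficient by coefficient in
    \<open>p\<close> and \<open>q\<close>.\<close>
  obtain p q where [simp]: "s = p + 2" "t = q + 2"
    using assms(2,3) by (metis le_add_diff_inverse2)
  show "t + 2 * s + 2 * s * t < n" "2 * s + 4 * t < n"
    "s * t\<^sup>2 + t * s\<^sup>2 + (s * t + 4)\<^sup>2 + 3 * s + 2 * t < n"
    by (rule less_le_trans[OF _ n]; simp add: power2_eq_square algebra_simps)+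
qed

theorem theorem1p5:
  fixes G :: "'a pair_pre_digraph" and n k \<delta> :: nat
  assumes "k \<ge> 3" and "\<delta> \<ge> k"
    and "pair_graph G"
    and "Digraph_Component.connected (with_proj G)"
    and "card (pverts G) = n"
    and "min_degree G = \<delta>"
    and "int n \<ge> F_bound (int k) (int \<delta>)"
    and "q_index G \<ge> 2 * (real n - real \<delta> + real k - 3)"
  shows "k_connected k G \<or> (\<exists>H \<in> A1_graphs n k \<delta>. isomorphic G H)"
  unfolding disj_imp
proof
  assume not_conn: "\<not> k_connected k G"
  interpret pair_graph G by fact
  have symG: "(u, v) \<in> parcs G \<longleftrightarrow> (v, u) \<in> parcs G" for u v
    using pair_sym_arcs by (auto simp: symmetric_def sym_def)
  have irr: "(u, u) \<notin> parcs G" for u using pair_no_loops[of "(u, u)"] by auto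
  define s t where "s = \<delta> + 2 - k" and "t = k - 1"
  have s: "2 \<le> s" and t: "2 \<le> t" using assms(1,2) by (auto simp: s_def t_def)
  have st: "s + t = \<delta> + 1" using assms(1,2) by (simp add: s_def t_def)
  have "int (t * (t + 4) * s\<^sup>2 + (t\<^sup>2 + 5 * t + 8) * s + t + 9) \<le> int n"
    using assms(1,2,7) F_bound_eq[OF _ _ s_def t_def] by linarith
  then have "n \<ge> t * (t + 4) * s\<^sup>2 + (t\<^sup>2 + 5 * t + 8) * s + t + 9"
    by (simp only: of_nat_le_iff)
  note n = order_bounds[OF this s t]
  have "card (pverts G) > k" "card (pverts G) \<ge> 2 * (k - 1)"
    using n(2) assms(5) t by (auto simp: t_def)
  from not_k_connected_partition[OF assms(3) not_conn this]
  obtain X Y Z where V: "pverts G = X \<union> Y \<union> Z"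
    and disj: "X \<inter> Y = {}" "X \<inter> Z = {}" "Y \<inter> Z = {}"
    and Y: "card Y = t" and X: "X \<noteq> {}" "2 * card X \<le> n"
    and XZ: "parcs G \<inter> X \<times> Z = {}" "parcs G \<inter> Z \<times> X = {}"
    unfolding assms(5) t_def[symmetric] by metis
  have fin: "finite X" "finite Y" "finite Z" using pair_finite_verts unfolding V by auto
  have E: "parcs G \<subseteq> (X \<union> Y \<union> Z) \<times> (X \<union> Y \<union> Z)"
    using arc_fst_in_verts arc_snd_in_verts unfolding V by fastforce
  have irreflE: "irrefl (parcs G)" using irr by (auto simp: irrefl_def)
  have symE: "sym (parcs G)" using symG by (auto simp: sym_def)
  have nbrs: "parcs G `` {u} \<subseteq> (X - {u}) \<union> Y" if "u \<in> X" for u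
    using that E XZ irr by auto
  have card_nbrs: "card ((X - {u}) \<union> Y) = card X - 1 + t" if "u \<in> X" for u
    using that fin disj Y by (subst card_Un_disjoint) auto
  have deg: "\<delta> \<le> card (parcs G `` {u})" if "u \<in> pverts G" for u
    using that pair_finite_verts
    by (auto simp: assms(6)[symmetric] min_degree_def vertex_degree_eq_card[symmetric] intro: Min_le)
  \<comment> \<open>A vertex of \<open>X\<close> has at most \<open>card X - 1 + t\<close>
    neighbours and at least \<open>\<delta> = s + t - 1\<close>.\<close>
  have "s \<le> card X"
  proof -
    obtain u where u: "u \<in> X" using X(1) by blast
    have "\<delta> \<le> card ((X - {u}) \<union> Y)"
      using deg[of u] card_mono[OF _ nbrs[OF u]] u fin unfolding V by fastforce
    then show ?thesis using card_nbrs[OF u] st card_gt_0_iff[of X] u fin by fastforce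
  qed
  have "pverts G \<noteq> {}" using X(1) V by blast
  then obtain x where x: "\<exists>v\<in>pverts G. x v \<noteq> 0"
    "\<And>u. u \<in> pverts G \<Longrightarrow> (\<Sum>v\<in>parcs G `` {u}. x u + x v) = q_index G * x u"
    using q_index_eigenfunction[OF assms(3)] by blast
  have \<mu>: "q_index G \<ge> 2 * (real n - real s - 1)"
    using assms(1,2,8) by (simp add: s_def of_nat_diff)
  have "card X = s"
  proof (rule ccontr)
    assume "card X \<noteq> s"
    then have "s < card X" using \<open>s \<le> card X\<close> by simp
    have "q_index G < 2 * (real n - real s - 1)"
      using x t unfolding V
      by (intro eigenvalue_less_large_part[OF fin disj E irreflE XZ _ _ Y _ X(2) \<open>s < card X\<close> _ n(1,2)])
        (use assms(5) in \<open>auto simp: V\<close>)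
    then show False using \<mu> by simp
  qed
  \<comment> \<open>With \<open>card X = s\<close> the possible neighbours number exactly
    \<open>\<delta>\<close>, so the minimum degree forces all of them.\<close>
  have full: "(u, v) \<in> parcs G" if "u \<in> X" "v \<in> X \<union> Y" "u \<noteq> v" for u v
  proof -
    have "card ((X - {u}) \<union> Y) \<le> card (parcs G `` {u})"
      using card_nbrs[OF that(1)] deg[of u] that(1) st s unfolding V \<open>card X = s\<close> by simp
    then have "parcs G `` {u} = (X - {u}) \<union> Y"
      using card_seteq[OF _ nbrs[OF that(1)]] fin by blast
    then show ?thesis using that by blast
  qed
  define W where "W = Y \<union> Z"
  have W: "X \<inter> W = {}" "finite W" "Y \<subseteq> W" "pverts G = X \<union> W"
    using disj fin V by (auto simp: W_def)
  have cardW: "card W + s = n"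
    using assms(5) card_Un_disjoint[of X W] fin W \<open>card X = s\<close> by simp
  define M where "M = {(u, v) \<in> W \<times> W. u \<noteq> v} - parcs G"
  have finM: "finite M"
    by (rule finite_subset[of _ "W \<times> W"]) (use W in \<open>auto simp: M_def\<close>)
  have "4 * card ((\<lambda>(u, v). {u, v}) ` M) \<le> s * t"
  proof (rule ccontr)
    assume many: "\<not> ?thesis"
    \<comment> \<open>The least integer above \<open>s * t / 4\<close>. Keeping only
      \<open>2 * e\<close> missing arcs secures \<open>4 * e \<le> s * t + 4\<close>, however many
      edges are missing.\<close>
    define e where "e = s * t div 4 + 1"
    have e: "s * t < 4 * e" "4 * e \<le> s * t + 4" by (auto simp: e_def)
    have "2 * card ((\<lambda>(u, v). {u, v}) ` M) \<le> card M"
      using symG by (intro card_doubletons_le finM) (auto simp: M_def sym_def irrefl_def)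
    moreover have "e \<le> card ((\<lambda>(u, v). {u, v}) ` M)" using many by (simp add: e_def)
    ultimately obtain M' where M': "M' \<subseteq> M" "card M' = 2 * e"
      using obtain_subset_with_card_n[of "2 * e" M] by auto
    have "M' \<subseteq> {(u, v) \<in> W \<times> W. u \<noteq> v}" using M'(1) by (auto simp: M_def)
    moreover have "parcs G \<subseteq> ({(u, v) \<in> W \<times> W. u \<noteq> v} - M') \<union> X \<times> Y \<union> Y \<times> X
        \<union> {(u, v) \<in> X \<times> X. u \<noteq> v}"
      using E XZ irr M'(1) by (fastforce simp: M_def W_def)
    ultimately have "q_index G < 2 * (real (card W) - 1)"
      using x unfolding W(4)
      by (intro eigenvalue_less_many_missing[OF fin(1) W(2,1,3) _ M'(2) symE _ _ _ \<open>card X = s\<close> Y refl _ e])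
        (use n(3) t cardW in auto)
    then show False using \<mu> cardW by auto
  qed
  moreover have "card Z = n - \<delta> - 1"
    using cardW fin disj(3) Y st by (simp add: W_def card_Un_disjoint)
  ultimately show "\<exists>H \<in> A1_graphs n k \<delta>. isomorphic G H"
    using \<open>card X = s\<close> Y assms(1,2)
    by (intro isomorphic_A1_graph[OF assms(3) V disj _ _ _ XZ full])
      (auto simp: M_def W_def s_def t_def)
qed

end
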